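(* Let $G_1$ be a broken sun graph which has no perfect matching and such that $2$ is an eigenvalue of $L(G_1)$. Let $G_2$ be a unicyclic graph such that $2$ is not an eigenvalue of $L(G_2)$. Let $u\in V(G_1)$ and $v\in V(G_2)$. Then $2$ is an eigenvalue of $L(G_1\odot_{uv}G_2)$ if and only if there exists an eigenvector $X$ of $L(G_1)$ corresponding to the eigenvalue $2$ with $x(u)=0$, where $x(u)$ denotes the entry of $X$ at the vertex $u$.
   Context: All graphs are finite, undirected, without loops or multiple edges. The Laplacian matrix of a graph $G$ is $L(G)=D(G)-A(G)$, where $D(G)$ is the diagonal matrix of vertex degrees and $A(G)$ is the adjacency matrix. A unicyclic graph is a connected graph whose number of edges equals its number of vertices. The sun graph of order $2n$ is the cycle $C_n$ with one pendant edge (ending in a leaf, i.e. a vertex of degree one) attached to each vertex of the cycle. A broken sun graph is a unicyclic subgraph of a sun graph, i.e. a cycle with at most one leaf attached to each of its vertices (sun graphs themselves are included). For graphs $G_1,G_2$ with disjoint vertex sets, $u\in V(G_1)$ and $v\in V(G_2)$, the one-edge connection $G_1\odot_{uv}G_2$ is the graph with vertex set $V(G_1)\cup V(G_2)$ and edge set $E(G_1)\cup E(G_2)\cup\{uv\}$. Eigenvectors are nonzero real vectors indexed by the vertices. *)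

theory Defs
  imports Complex_Main "Graph_Theory.Graph_Theory" "Jordan_Normal_Form.Char_Poly"
begin

text \<open>
  A finite simple undirected graph is a \<open>pair_graph\<close>: a finite loop-free digraph whose arc
  relation is symmetric, so that an undirected edge is a pair of opposite arcs.
\<close>

definition edges :: "'a pair_pre_digraph \<Rightarrow> 'a set set" where
  "edges G = (\<lambda>(u, w). {u, w}) ` parcs G"

definition unicyclic :: "'a pair_pre_digraph \<Rightarrow> bool" where
  "unicyclic G \<longleftrightarrow> pair_graph G \<and> Digraph_Component.connected (with_proj G) \<and>
     card (edges G) = card (pverts G)"

definition has_perfect_matching :: "'a pair_pre_digraph \<Rightarrow> bool" where
  "has_perfect_matching G \<longleftrightarrow> (\<exists>M \<subseteq> edges G. \<forall>w \<in> pverts G. \<exists>!e. e \<in> M \<and> w \<in> e)"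

text \<open>
  In the sun graph of order \<open>2 * n\<close> the vertices \<open>(i, False)\<close> form the cycle, and \<open>(i, True)\<close> is
  the leaf at \<open>(i, False)\<close>. The definition is only meaningful for \<open>n \<ge> 3\<close>.
\<close>

definition sun_graph :: "nat \<Rightarrow> (nat \<times> bool) pair_pre_digraph" where
  "sun_graph n = \<lparr> pverts = {..<n} \<times> UNIV,
     parcs = (\<Union>i<n. {((i, False), (Suc i mod n, False)), ((Suc i mod n, False), (i, False)),
                      ((i, False), (i, True)), ((i, True), (i, False))}) \<rparr>"

definition broken_sun_graph :: "'a pair_pre_digraph \<Rightarrow> bool" where
  "broken_sun_graph G \<longleftrightarrow> unicyclic G \<and>
     (\<exists>n H. n \<ge> 3 \<and> subgraph (with_proj H) (with_proj (sun_graph n)) \<and>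
        digraph_iso (with_proj G) (with_proj H))"

definition one_edge_connection ::
  "'a pair_pre_digraph \<Rightarrow> 'a \<Rightarrow> 'a \<Rightarrow> 'a pair_pre_digraph \<Rightarrow> 'a pair_pre_digraph" where
  "one_edge_connection G\<^sub>1 u v G\<^sub>2 =
     \<lparr> pverts = pverts G\<^sub>1 \<union> pverts G\<^sub>2, parcs = parcs G\<^sub>1 \<union> parcs G\<^sub>2 \<union> {(u, v), (v, u)} \<rparr>"

text \<open>
  Matrices and vectors indexed by the vertices of \<open>G\<close> are functions on the vertex type, of which
  only the values on \<open>pverts G\<close> matter.
\<close>

definition degree_matrix :: "'a pair_pre_digraph \<Rightarrow> 'a \<Rightarrow> 'a \<Rightarrow> real" where
  "degree_matrix G i j = (if i = j then real (out_degree (with_proj G) i) else 0)"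

definition adjacency_matrix :: "'a pair_pre_digraph \<Rightarrow> 'a \<Rightarrow> 'a \<Rightarrow> real" where
  "adjacency_matrix G i j = (if (i, j) \<in> parcs G then 1 else 0)"

definition laplacian :: "'a pair_pre_digraph \<Rightarrow> 'a \<Rightarrow> 'a \<Rightarrow> real" where
  "laplacian G i j = degree_matrix G i j - adjacency_matrix G i j"

definition eigenvector_on :: "'a set \<Rightarrow> ('a \<Rightarrow> 'a \<Rightarrow> real) \<Rightarrow> ('a \<Rightarrow> real) \<Rightarrow> real \<Rightarrow> bool" where
  "eigenvector_on V M x k \<longleftrightarrow>
     (\<exists>i\<in>V. x i \<noteq> 0) \<and> (\<forall>i\<in>V. (\<Sum>j\<in>V. M i j * x j) = k * x i)"

definition laplacian_eigenvector :: "'a pair_pre_digraph \<Rightarrow> ('a \<Rightarrow> real) \<Rightarrow> real \<Rightarrow> bool" where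
  "laplacian_eigenvector G x k \<longleftrightarrow> eigenvector_on (pverts G) (laplacian G) x k"

definition laplacian_eigenvalue :: "'a pair_pre_digraph \<Rightarrow> real \<Rightarrow> bool" where
  "laplacian_eigenvalue G k \<longleftrightarrow> (\<exists>x. laplacian_eigenvector G x k)"

text \<open>
  For every enumeration of the index set, these are the eigenvectors and eigenvalues of the
  enumerated matrix.
\<close>

lemma eigenvector_on_iff_eigenvector:
  assumes f: "bij_betw f {0..<n} V"
  shows "eigenvector_on V M x k \<longleftrightarrow>
    eigenvector (mat n n (\<lambda>(i, j). M (f i) (f j))) (vec n (\<lambda>i. x (f i))) k"
proof -
  have V: "V = f ` {0..<n}" and inj: "inj_on f {0..<n}"
    using f by (auto simp: bij_betw_def)
  have sum: "(\<Sum>j\<in>V. M i j * x j) = (\<Sum>j = 0..<n. M i (f j) * x (f j))" for i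
    unfolding V using inj by (simp add: sum.reindex)
  have "vec n (\<lambda>i. x (f i)) \<noteq> 0\<^sub>v n \<longleftrightarrow> (\<exists>i\<in>V. x i \<noteq> 0)"
    unfolding V by (auto simp: vec_eq_iff)
  moreover have "mat n n (\<lambda>(i, j). M (f i) (f j)) *\<^sub>v vec n (\<lambda>i. x (f i)) = k \<cdot>\<^sub>v vec n (\<lambda>i. x (f i))
      \<longleftrightarrow> (\<forall>i\<in>V. (\<Sum>j\<in>V. M i j * x j) = k * x i)"
    unfolding V sum[unfolded V] by (auto simp: vec_eq_iff scalar_prod_def)
  ultimately show ?thesis
    by (simp add: eigenvector_on_def eigenvector_def)
qed

lemma laplacian_eigenvalue_iff_eigenvalue:
  assumes f: "bij_betw f {0..<n} (pverts G)"
  shows "laplacian_eigenvalue G k \<longleftrightarrow>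
    eigenvalue (mat n n (\<lambda>(i, j). laplacian G (f i) (f j))) k"
    (is "_ \<longleftrightarrow> eigenvalue ?L k")
proof
  assume "laplacian_eigenvalue G k"
  then show "eigenvalue ?L k"
    using eigenvector_on_iff_eigenvector[OF f]
    by (auto simp: laplacian_eigenvalue_def laplacian_eigenvector_def eigenvalue_def)
next
  assume "eigenvalue ?L k"
  then obtain y where y: "eigenvector ?L y k"
    by (auto simp: eigenvalue_def)
  define x where "x w = y $ (the_inv_into {0..<n} f w)" for w
  have "vec n (\<lambda>i. x (f i)) = y"
  proof (rule eq_vecI)
    show dim: "dim_vec (vec n (\<lambda>i. x (f i))) = dim_vec y"
      using y by (auto simp: eigenvector_def)
    have "the_inv_into {0..<n} f (f i) = i" if "i < n" for i
      using that f by (intro the_inv_into_f_f) (auto simp: bij_betw_def)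
    then show "vec n (\<lambda>i. x (f i)) $ i = y $ i" if "i < dim_vec y" for i
      using that dim by (simp add: x_def)
  qed
  then have "laplacian_eigenvector G x k"
    using y by (simp add: laplacian_eigenvector_def eigenvector_on_iff_eigenvector[OF f])
  then show "laplacian_eigenvalue G k"
    by (auto simp: laplacian_eigenvalue_def)
qed

lemma pair_graphI:
  assumes "finite (pverts G)" and "parcs G \<subseteq> pverts G \<times> pverts G"
    and "\<And>w. (w, w) \<notin> parcs G" and "\<And>a b. (a, b) \<in> parcs G \<Longrightarrow> (b, a) \<in> parcs G"
  shows "pair_graph G"
proof unfold_locales
  show "finite (parcs G)"
    using assms(1,2) by (meson finite_SigmaI finite_subset)
  show "symmetric (with_proj G)"
    using assms(4) by (simp add: symmetric_def sym_def)
  show "fst e \<noteq> snd e" if "e \<in> parcs G" for e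
    using that assms(3) by (cases e) auto
qed (use assms(1,2) in auto)

lemma pair_graph_sun_graph:
  assumes "n \<ge> 3"
  shows "pair_graph (sun_graph n)"
proof (rule pair_graphI)
  have neq: "Suc i mod n \<noteq> i" if "i < n" for i
    using assms that by (cases "Suc i = n") auto
  show "(w, w) \<notin> parcs (sun_graph n)" for w
  proof
    assume "(w, w) \<in> parcs (sun_graph n)"
    then obtain i where "i < n" "Suc i mod n = i"
      unfolding sun_graph_def by force
    with neq show False by blast
  qed
qed (use assms in \<open>auto simp: sun_graph_def\<close>)

lemma pair_graph_one_edge_connection:
  assumes "pair_graph G\<^sub>1" "pair_graph G\<^sub>2" "pverts G\<^sub>1 \<inter> pverts G\<^sub>2 = {}"
    and "u \<in> pverts G\<^sub>1" "v \<in> pverts G\<^sub>2"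
  shows "pair_graph (one_edge_connection G\<^sub>1 u v G\<^sub>2)"
proof -
  interpret G1: pair_graph G\<^sub>1 by fact
  interpret G2: pair_graph G\<^sub>2 by fact
  have fin: "finite (pverts G\<^sub>1)" "finite (pverts G\<^sub>2)"
    by (rule G1.pair_finite_verts G2.pair_finite_verts)+
  have uv: "u \<noteq> v"
    using assms by blast
  show ?thesis
  proof (rule pair_graphI)
    show "(w, w) \<notin> parcs (one_edge_connection G\<^sub>1 u v G\<^sub>2)" for w
      using uv G1.no_loops' G2.no_loops' by (auto simp: one_edge_connection_def)
    show "(b, a) \<in> parcs (one_edge_connection G\<^sub>1 u v G\<^sub>2)"
      if "(a, b) \<in> parcs (one_edge_connection G\<^sub>1 u v G\<^sub>2)" for a b
      using that G1.arcs_symmetric G2.arcs_symmetric by (auto simp: one_edge_connection_def)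
    show "parcs (one_edge_connection G\<^sub>1 u v G\<^sub>2) \<subseteq>
        pverts (one_edge_connection G\<^sub>1 u v G\<^sub>2) \<times> pverts (one_edge_connection G\<^sub>1 u v G\<^sub>2)"
      using assms(4,5) G1.wellformed' G2.wellformed'
      unfolding one_edge_connection_def by (simp add: subset_iff)
  qed (simp add: one_edge_connection_def fin)
qed

end

(* With c = z(u) - z(v), the restrictions of a vector z with L(G) z = 2 z satisfy
   (L(G1) - 2) z1 = - c e_u and (L(G2) - 2) z2 = c e_v. Pairing the first equation with an
   eigenvector X of the symmetric matrix L(G1) gives c X(u) = 0. If X(u) is nonzero then c = 0, so
   z2 = 0 because 2 is not an eigenvalue of L(G2), and z1 is an eigenvector with
   z1(u) = z(v) = 0. Conversely, an eigenvector of L(G1) vanishing at u extends by zero. *)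

theory Submission
  imports Defs
begin

text \<open>As a sum of differences over neighbours, the action of the Laplacian at \<open>i\<close>
  gains exactly one summand when an edge at \<open>i\<close> is added. The degree supplies one copy
  of \<open>x i\<close> for each neighbour.\<close>

lemma laplacian_apply:
  assumes "pair_graph G" and i: "i \<in> pverts G"
  shows "(\<Sum>j\<in>pverts G. laplacian G i j * x j) = (\<Sum>j | (i, j) \<in> parcs G. x i - x j)"
proof -
  interpret pair_graph G by fact
  let ?N = "{j. (i, j) \<in> parcs G}"
  have N: "?N \<subseteq> pverts G"
    using wellformed' by blast
  \<comment> \<open>\<open>out_degree\<close> counts arcs rather than neighbours; the injective map
    \<open>Pair i\<close> identifies the two.\<close>
  have "out_arcs (with_proj G) i = Pair i ` ?N"
    by (auto simp: out_arcs_def)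
  then have deg: "out_degree (with_proj G) i = card ?N"
    by (simp add: out_degree_def card_image inj_on_def)
  have "(\<Sum>j\<in>pverts G. laplacian G i j * x j)
      = (\<Sum>j\<in>pverts G. degree_matrix G i j * x j) - (\<Sum>j\<in>pverts G. adjacency_matrix G i j * x j)"
    by (simp add: laplacian_def left_diff_distrib sum_subtractf)
  also have "(\<Sum>j\<in>pverts G. degree_matrix G i j * x j) = real (card ?N) * x i"
  proof -
    have "(\<Sum>j\<in>pverts G. degree_matrix G i j * x j)
        = (\<Sum>j\<in>pverts G. if i = j then real (card ?N) * x j else 0)"
      by (intro sum.cong) (auto simp: degree_matrix_def deg)
    then show ?thesis
      using i pair_finite_verts by simp
  qed
  also have "(\<Sum>j\<in>pverts G. adjacency_matrix G i j * x j) = (\<Sum>j\<in>?N. x j)"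
  proof (rule sum.mono_neutral_cong_right)
    show "finite (pverts G)"
      by (rule pair_finite_verts)
  qed (use N in \<open>auto simp: adjacency_matrix_def\<close>)
  finally show ?thesis
    by (simp add: sum_subtractf)
qed

lemma laplacian_sym:
  assumes "pair_graph G"
  shows "laplacian G i j = laplacian G j i"
proof -
  interpret pair_graph G by fact
  show ?thesis
    using arcs_symmetric by (auto simp: laplacian_def degree_matrix_def adjacency_matrix_def)
qed

text \<open>Symmetry of the matrix together with an exchange of the two summations. It serves to
  pair the equation for a restricted vector with an eigenvector.\<close>

lemma laplacian_self_adjoint:
  assumes "pair_graph G"
  shows "(\<Sum>i\<in>pverts G. y i * (\<Sum>j\<in>pverts G. laplacian G i j * x j))
    = (\<Sum>i\<in>pverts G. x i * (\<Sum>j\<in>pverts G. laplacian G i j * y j))"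
proof -
  have "(\<Sum>i\<in>pverts G. y i * (\<Sum>j\<in>pverts G. laplacian G i j * x j))
      = (\<Sum>i\<in>pverts G. \<Sum>j\<in>pverts G. x j * (laplacian G j i * y i))"
    by (simp add: sum_distrib_left laplacian_sym[OF assms] mult_ac)
  also have "\<dots> = (\<Sum>j\<in>pverts G. \<Sum>i\<in>pverts G. x j * (laplacian G j i * y i))"
    by (rule sum.swap)
  finally show ?thesis
    by (simp add: sum_distrib_left)
qed

text \<open>This symmetry lets a formula proved at the vertices of the first graph be reused at
  those of the second.\<close>

lemma one_edge_connection_commute:
  "one_edge_connection G\<^sub>1 u v G\<^sub>2 = one_edge_connection G\<^sub>2 v u G\<^sub>1"
  by (auto simp: one_edge_connection_def)

text \<open>Among the vertices of \<open>G\<^sub>1\<close>, only \<open>u\<close> gets a new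
  neighbour, namely \<open>v\<close>, and this contributes the single difference
  \<open>x u - x v\<close>.\<close>

lemma laplacian_one_edge_connection_apply:
  assumes "pair_graph G\<^sub>1" "pair_graph G\<^sub>2" and disj: "pverts G\<^sub>1 \<inter> pverts G\<^sub>2 = {}"
    and "u \<in> pverts G\<^sub>1" "v \<in> pverts G\<^sub>2" and i: "i \<in> pverts G\<^sub>1"
  defines "G \<equiv> one_edge_connection G\<^sub>1 u v G\<^sub>2"
  shows "(\<Sum>j\<in>pverts G. laplacian G i j * x j)
    = (\<Sum>j\<in>pverts G\<^sub>1. laplacian G\<^sub>1 i j * x j) + (if i = u then x u - x v else 0)"
proof -
  interpret G1: pair_graph G\<^sub>1 by fact
  interpret G2: pair_graph G\<^sub>2 by fact
  let ?N = "{j. (i, j) \<in> parcs G\<^sub>1}"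
  have G: "pair_graph G"
    unfolding G_def using assms by (intro pair_graph_one_edge_connection)
  have iG: "i \<in> pverts G"
    using i by (simp add: G_def one_edge_connection_def)
  have "?N \<subseteq> pverts G\<^sub>1"
    using G1.wellformed' by blast
  \<comment> \<open>Since \<open>v\<close> is new to \<open>?N\<close>, the sum over
    \<open>insert v ?N\<close> splits off its term.\<close>
  then have fin: "finite ?N" and v: "v \<notin> ?N"
    using G1.pair_finite_verts assms(5) disj by (auto intro: finite_subset)
  \<comment> \<open>Neither the reverse arc \<open>(v, u)\<close> nor any arc of
    \<open>G\<^sub>2\<close> starts at \<open>i\<close>.\<close>
  have "i \<noteq> v" "(i, j) \<notin> parcs G\<^sub>2" for j
    using i disj assms(5) G2.wellformed' by blast+
  then have nb: "{j. (i, j) \<in> parcs G} = (if i = u then insert v ?N else ?N)"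
    by (auto simp: G_def one_edge_connection_def)
  show ?thesis
    unfolding laplacian_apply[OF G iG] laplacian_apply[OF assms(1) i] nb
    using fin v by (cases "i = u") auto
qed

lemma laplacian_eigenvalue_one_edge_connection_iff:
  assumes G1: "pair_graph G\<^sub>1" and G2: "pair_graph G\<^sub>2"
    and ev1: "laplacian_eigenvalue G\<^sub>1 k" and ev2: "\<not> laplacian_eigenvalue G\<^sub>2 k"
    and disj: "pverts G\<^sub>1 \<inter> pverts G\<^sub>2 = {}" and u: "u \<in> pverts G\<^sub>1" and v: "v \<in> pverts G\<^sub>2"
  shows "laplacian_eigenvalue (one_edge_connection G\<^sub>1 u v G\<^sub>2) k \<longleftrightarrow>
    (\<exists>x. laplacian_eigenvector G\<^sub>1 x k \<and> x u = 0)"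
proof -
  let ?G = "one_edge_connection G\<^sub>1 u v G\<^sub>2"
  have verts: "pverts ?G = pverts G\<^sub>1 \<union> pverts G\<^sub>2"
    by (simp add: one_edge_connection_def)
  have app1: "(\<Sum>j\<in>pverts ?G. laplacian ?G i j * x j)
      = (\<Sum>j\<in>pverts G\<^sub>1. laplacian G\<^sub>1 i j * x j) + (if i = u then x u - x v else 0)"
    if "i \<in> pverts G\<^sub>1" for i x
    using G1 G2 disj u v that by (rule laplacian_one_edge_connection_apply)
  have disj': "pverts G\<^sub>2 \<inter> pverts G\<^sub>1 = {}"
    using disj by blast
  \<comment> \<open>With the roles of the two graphs exchanged, the correction at \<open>v\<close>
    has the opposite sign.\<close>
  have app2: "(\<Sum>j\<in>pverts ?G. laplacian ?G i j * x j)
      = (\<Sum>j\<in>pverts G\<^sub>2. laplacian G\<^sub>2 i j * x j) + (if i = v then x v - x u else 0)"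
    if "i \<in> pverts G\<^sub>2" for i x
    unfolding one_edge_connection_commute[of G\<^sub>1]
    using G2 G1 disj' v u that by (rule laplacian_one_edge_connection_apply)
  show ?thesis
  proof
    assume "laplacian_eigenvalue ?G k"
    then obtain z where nz: "\<exists>i\<in>pverts ?G. z i \<noteq> 0"
      and eq: "\<And>i. i \<in> pverts ?G \<Longrightarrow> (\<Sum>j\<in>pverts ?G. laplacian ?G i j * z j) = k * z i"
      by (auto simp: laplacian_eigenvalue_def laplacian_eigenvector_def eigenvector_on_def)
    obtain x where x: "laplacian_eigenvector G\<^sub>1 x k"
      using ev1 by (auto simp: laplacian_eigenvalue_def)
    have eq1: "(\<Sum>j\<in>pverts G\<^sub>1. laplacian G\<^sub>1 i j * z j) = k * z i - (if i = u then z u - z v else 0)"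
      if "i \<in> pverts G\<^sub>1" for i
      using app1[OF that, of z] eq[of i] that verts by simp
    have eq2: "(\<Sum>j\<in>pverts G\<^sub>2. laplacian G\<^sub>2 i j * z j) = k * z i - (if i = v then z v - z u else 0)"
      if "i \<in> pverts G\<^sub>2" for i
      using app2[OF that, of z] eq[of i] that verts by simp
    show "\<exists>x. laplacian_eigenvector G\<^sub>1 x k \<and> x u = 0"
    proof (cases "x u = 0")
      case True
      with x show ?thesis by blast
    next
      case False
      have fin: "finite (pverts G\<^sub>1)"
      proof -
        interpret pair_graph G\<^sub>1 by (rule G1)
        show ?thesis by (rule pair_finite_verts)
      qed
      \<comment> \<open>The inner product of \<open>z\<close> and \<open>k * x\<close> over
        \<open>G\<^sub>1\<close> is computed in two ways. It cancels from both ends of the chain and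
        leaves \<open>x u * (z u - z v) = 0\<close>.\<close>
      have "(\<Sum>i\<in>pverts G\<^sub>1. z i * (k * x i))
          = (\<Sum>i\<in>pverts G\<^sub>1. z i * (\<Sum>j\<in>pverts G\<^sub>1. laplacian G\<^sub>1 i j * x j))"
        using x by (simp add: laplacian_eigenvector_def eigenvector_on_def)
      also have "\<dots> = (\<Sum>i\<in>pverts G\<^sub>1. x i * (\<Sum>j\<in>pverts G\<^sub>1. laplacian G\<^sub>1 i j * z j))"
        by (rule laplacian_self_adjoint[OF G1])
      also have "\<dots> = (\<Sum>i\<in>pverts G\<^sub>1. z i * (k * x i) - (if i = u then x u * (z u - z v) else 0))"
        by (intro sum.cong refl) (simp only: eq1, simp add: algebra_simps)
      also have "\<dots> = (\<Sum>i\<in>pverts G\<^sub>1. z i * (k * x i)) - x u * (z u - z v)"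
        using fin u by (simp add: sum_subtractf)
      finally have zuv: "z u = z v"
        using False by simp
      have "(\<Sum>j\<in>pverts G\<^sub>2. laplacian G\<^sub>2 i j * z j) = k * z i" if "i \<in> pverts G\<^sub>2" for i
        using eq2[OF that] zuv by simp
      \<comment> \<open>Otherwise \<open>z\<close> would be an eigenvector of
        \<open>G\<^sub>2\<close> for \<open>k\<close>, contrary to \<open>ev2\<close>.\<close>
      then have z2: "z i = 0" if "i \<in> pverts G\<^sub>2" for i
        using ev2 that
        unfolding laplacian_eigenvalue_def laplacian_eigenvector_def eigenvector_on_def by blast
      then have "\<exists>i\<in>pverts G\<^sub>1. z i \<noteq> 0"
        using nz verts by auto
      \<comment> \<open>Only values on \<open>pverts G\<^sub>1\<close> matter here, so
        \<open>z\<close> itself serves as its restriction.\<close>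
      then have "laplacian_eigenvector G\<^sub>1 z k"
        using eq1 zuv by (simp add: laplacian_eigenvector_def eigenvector_on_def)
      then show ?thesis
        using zuv z2[OF v] by auto
    qed
  next
    assume "\<exists>x. laplacian_eigenvector G\<^sub>1 x k \<and> x u = 0"
    then obtain x where x: "laplacian_eigenvector G\<^sub>1 x k" and xu: "x u = 0"
      by blast
    \<comment> \<open>The function \<open>x\<close> may take any values outside
      \<open>pverts G\<^sub>1\<close>, so it is cut off there. Then \<open>z u = z v = 0\<close>,
      and the correction terms at both ends of the new edge vanish.\<close>
    define z where "z i = (if i \<in> pverts G\<^sub>1 then x i else 0)" for i
    have z2: "z i = 0" if "i \<in> pverts G\<^sub>2" for i
      using that disj by (auto simp: z_def)
    have zu: "z u = 0"
      using xu by (simp add: z_def)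
    have "(\<Sum>j\<in>pverts ?G. laplacian ?G i j * z j) = k * z i" if "i \<in> pverts ?G" for i
    proof (cases "i \<in> pverts G\<^sub>1")
      case True
      then show ?thesis
        using x z2[OF v] zu app1[OF True, of z]
        by (simp add: z_def laplacian_eigenvector_def eigenvector_on_def)
    next
      case False
      then have i: "i \<in> pverts G\<^sub>2"
        using that verts by blast
      then show ?thesis
        using z2 v zu app2[OF i, of z] by simp
    qed
    moreover have "\<exists>i\<in>pverts ?G. z i \<noteq> 0"
      using x unfolding laplacian_eigenvector_def eigenvector_on_def verts z_def by auto
    ultimately show "laplacian_eigenvalue ?G k"
      unfolding laplacian_eigenvalue_def laplacian_eigenvector_def eigenvector_on_def by blast
  qed
qed

theorem theorem7:
  fixes G\<^sub>1 G\<^sub>2 :: "'a pair_pre_digraph" and u v :: 'a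
  assumes "broken_sun_graph G\<^sub>1"
    and "\<not> has_perfect_matching G\<^sub>1"
    and "laplacian_eigenvalue G\<^sub>1 2"
    and "unicyclic G\<^sub>2"
    and "\<not> laplacian_eigenvalue G\<^sub>2 2"
    and "pverts G\<^sub>1 \<inter> pverts G\<^sub>2 = {}"
    and "u \<in> pverts G\<^sub>1"
    and "v \<in> pverts G\<^sub>2"
  shows "laplacian_eigenvalue (one_edge_connection G\<^sub>1 u v G\<^sub>2) 2 \<longleftrightarrow>
    (\<exists>x. laplacian_eigenvector G\<^sub>1 x 2 \<and> x u = 0)"
proof (rule laplacian_eigenvalue_one_edge_connection_iff)
  show "pair_graph G\<^sub>1" "pair_graph G\<^sub>2"
    using assms(1,4) by (auto simp: broken_sun_graph_def unicyclic_def)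
qed (use assms in auto)

end
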